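(* Let $f:\mathbb{R}^n\to\mathbb{R}$ be continuously differentiable and suppose that the directions $d_k$ are calculated by the method SMCG_PR (i.e. by SMCG_PR1 or by SMCG_PR2) described in the context, with $g_k\neq0$ for every $k$. Then there exists a constant $c_1>0$, independent of $k$, such that for every $k$ $$g_k^Td_k\le -c_1\|g_k\|^2 .$$
   Context: Notation: $f_k=f(x_k)$, $g_k=\nabla f(x_k)$, $s_{k-1}=x_k-x_{k-1}$, $y_{k-1}=g_k-g_{k-1}$, $\|\cdot\|$ is the Euclidean norm. SMCG_PR. Fixed parameters: $p>2$ (explicit root formulas are used for $p=3,4$), $0<\delta<\sigma<1$, positive constants $\xi_1,\xi_2,\xi_4,\xi_5$, $\xi_3\in(0,1)$, small positive thresholds $\tau_1,\tau_2$, $\gamma\in(0,1)$, positive integers MaxRestart, MinQuad. Start: $x_0\in\mathbb{R}^n$, $d_0=-g_0$. Iteration: $x_{k+1}=x_k+\alpha_kd_k$, where $\alpha_k>0$ satisfies the nonmonotone Wolfe conditions $f(x_k+\alpha_kd_k)\le C_k+\delta\alpha_kg_k^Td_k$ and $\nabla f(x_k+\alpha_kd_k)^Td_k\ge\sigma g_k^Td_k$. Here $C_0=f_0$, $Q_0=1$, $C_1=\min\{C_0,f_1+1\}$, $Q_1=2$, and for $k\ge1$: $Q_{k+1}=\eta_kQ_k+1$, $C_{k+1}=(\eta_kQ_kC_k+f_{k+1})/Q_{k+1}$, where, with $l=\max(20,n)$, $\eta_k=1$ if $l\nmid k$, while if $l\mid k$ then $\eta_k=0.7$ when $C_k-f_{k+1}>0.999|C_k|$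 and $\eta_k=0.999$ otherwise. Consequently $s_{k-1}^Ty_{k-1}>0$ for $k\ge1$. Direction $d_k$, $k\ge1$ (a test containing an undefined quantity is regarded as failing). Tests: - (Q) at least one of the following holds: (i) $t_k\le\tau_1$, or ($t_k\le\tau_2$ and $t_{k-1}\le\tau_2$), where $t_k=\left|\frac{2(f_{k-1}-f_k+g_k^Ts_{k-1})}{s_{k-1}^Ty_{k-1}}-1\right|$; (ii) $|\theta_k-1|<\gamma$, where $\theta_k=\frac{f_{k-1}-f_k}{0.5\,s_{k-1}^Ty_{k-1}-g_k^Ts_{k-1}}$; (iii) $(s_{k-1}^Ty_{k-1})^2\le10^{-5}\|s_{k-1}\|^2\|y_{k-1}\|^2$ and $\left(f_k-f_{k-1}-0.5(g_{k-1}^Ts_{k-1}+g_k^Ts_{k-1})\right)^2\le10^{-6}\|s_{k-1}\|^2\|y_{k-1}\|^2$. - (W) $\xi_1\le\frac{s_{k-1}^Ty_{k-1}}{\|s_{k-1}\|^2}\le\frac{\|y_{k-1}\|^2}{s_{k-1}^Ty_{k-1}}\le\xi_2$. - (S) $\frac{|g_k^Ty_{k-1}\,g_k^Ts_{k-1}|}{s_{k-1}^Ty_{k-1}\|g_k\|^2}\le\xi_3$ and $\xi_1\le\frac{s_{k-1}^Ty_{k-1}}{\|s_{k-1}\|^2}$. Quantities: $\rho_k=\frac32\frac{\|y_{k-1}\|^2}{s_{k-1}^Ty_{k-1}}\|g_k\|^2$, $B_k=\begin{pmatrix}\rho_k & g_k^Ty_{k-1} \\ g_k^Ty_{k-1}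 & s_{k-1}^Ty_{k-1}\end{pmatrix}$, $\Delta_k=\det B_k$, $b_k=(\|g_k\|^2,\,g_k^Ts_{k-1})^T$, $E_k=\begin{pmatrix}\|g_k\|^2 & g_k^Ts_{k-1} \\ g_k^Ts_{k-1} & \|s_{k-1}\|^2\end{pmatrix}$, $\bar\mu_k=\frac{1}{\Delta_k}(g_k^Ty_{k-1}g_k^Ts_{k-1}-s_{k-1}^Ty_{k-1}\|g_k\|^2)$, $\bar\nu_k=\frac1{\Delta_k}(g_k^Ty_{k-1}\|g_k\|^2-\rho_kg_k^Ts_{k-1})$. Restart counters IterRestart, IterQuad, Isnotgra start at $0$. Once $x_k$ ($k\ge1$) is computed, IterRestart is increased by 1; with $r_{k-1}=\left|\frac{f_k}{f_{k-1}+0.5(g_{k-1}^Ts_{k-1}+g_k^Ts_{k-1})}-1\right|$ and $\bar r_{k-1}=|f_k-f_{k-1}-0.5(g_{k-1}^Ts_{k-1}+g_k^Ts_{k-1})|$, IterQuad is increased by 1 if $r_{k-1}\le\xi_4$ or $\bar r_{k-1}\le\xi_5$, and reset to $0$ otherwise. Then: 1. If Isnotgra $=$ MaxRestart, or (IterQuad $=$ MinQuad and IterRestart $\ne$ IterQuad): $d_k=-g_k$; reset Isnotgra and IterRestart to $0$. 2. Otherwise, if (W) and (Q) hold: $d_k=\bar\mu_kg_k+\bar\nu_ks_{k-1}$; increase Isnotgra by 1. 3. Otherwise, if (W) holds and (Q) fails: $d_k$ is the regularized direction below; increase Isnotgra by 1. 4. Otherwise ((W) fails), if (S) holds: $d_k=-g_k+\frac{g_k^Ty_{k-1}}{d_{k-1}^Ty_{k-1}}d_{k-1}$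 (Hestenes–Stiefel direction); increase Isnotgra by 1. 5. Otherwise: $d_k=-g_k$; reset Isnotgra and IterRestart to $0$. Regularized direction in SMCG_PR1: $\sigma_k=p\,|f_{k-1}-f_k+g_k^Ts_{k-1}-\frac12s_{k-1}^Ty_{k-1}|/(s_{k-1}^Ty_{k-1})^{p/2}$, $z^*$ is the unique positive solution of $\sigma_kz^{p-1}+z-\sqrt{b_k^TB_k^{-1}b_k}=0$, and $d_k=\frac{1}{1+\min\{\sigma_k(z^* )^{p-2},1\}}(\bar\mu_kg_k+\bar\nu_ks_{k-1})$. Regularized direction in SMCG_PR2: $d_k=\hat\mu_kg_k+\hat\nu_ks_{k-1}$ with $\hat\mu_k=\frac1{\bar\Delta_k}\left(g_k^Ty_{k-1}g_k^Ts_{k-1}-s_{k-1}^Ty_{k-1}\|g_k\|^2+\lambda(g_k^Ts_{k-1})^2-\lambda\|s_{k-1}\|^2\|g_k\|^2\right)$, $\hat\nu_k=\frac1{\bar\Delta_k}\left(g_k^Ty_{k-1}\|g_k\|^2-\rho_kg_k^Ts_{k-1}\right)$, $\bar\Delta_k=(\rho_k+\lambda\|g_k\|^2)(s_{k-1}^Ty_{k-1}+\lambda\|s_{k-1}\|^2)-(g_k^Ty_{k-1}+\lambda g_k^Ts_{k-1})^2$. If $(g_k^Ts_{k-1})^2>(1-10^{-5})\|g_k\|^2\|s_{k-1}\|^2$ then $\lambda=0$; otherwise $\lambda=\min\left\{\sigma_k(z^* )^{p-2},\frac{\|y_{k-1}\|^2}{s_{k-1}^Ty_{k-1}}\right\}$,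 where $\sigma_k=p\,|f_{k-1}-f_k+g_k^Ts_{k-1}-\frac12s_{k-1}^Ty_{k-1}|/\|s_{k-1}\|^{p/2}$ and $z^*$ is the unique non-negative solution of $z^2=\sum_{i=1}^2\frac{\beta_i^2}{(\mu_i+\sigma_kz^{p-2})^2}$, with $0<\mu_1\le\mu_2$ the eigenvalues of $E_k^{-1/2}B_kE_k^{-1/2}$, $V$ orthogonal with $V^TE_k^{-1/2}B_kE_k^{-1/2}V=\mathrm{diag}(\mu_1,\mu_2)$ and $\beta=V^TE_k^{-1/2}b_k$. *)

theory Defs
  imports "HOL-Analysis.Analysis"
begin

definition psd_sqrt :: "real^'m^'m \<Rightarrow> real^'m^'m" where
  "psd_sqrt A = (THE R. transpose R = R \<and> (\<forall>v. 0 \<le> v \<bullet> (R *v v)) \<and> R ** R = A)"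

definition inv_sqrt :: "real^'m^'m \<Rightarrow> real^'m^'m" where
  "inv_sqrt A = matrix_inv (psd_sqrt A)"

datatype step_kind = Neg_Gradient | Quadratic | Regularized | Hestenes_Stiefel

text \<open>
  Everything below is a function of a given infinite sequence of iterates.  No
  assumptions are attached to the locale; they are collected in \<open>pr1_run\<close> and
  \<open>pr2_run\<close>.  \<open>s j\<close> and \<open>y j\<close> are the differences between the iterates \<open>j\<close> and
  \<open>Suc j\<close>; a quantity with argument \<open>k\<close> that mentions \<open>k - 1\<close> is meant for \<open>1 \<le> k\<close>.
  Tests are guarded so that they fail when one of their quotients has denominator zero
  (or, for \<open>t\<close>, when the index is zero).
\<close>

locale smcg_pr =
  fixes p \<delta> \<sigma> \<xi>\<^sub>1 \<xi>\<^sub>2 \<xi>\<^sub>3 \<xi>\<^sub>4 \<xi>\<^sub>5 \<tau>\<^sub>1 \<tau>\<^sub>2 \<gamma> :: real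
    and MaxRestart MinQuad :: nat
    and f :: "real^'n \<Rightarrow> real"
    and gradf :: "real^'n \<Rightarrow> real^'n"
    and x :: "nat \<Rightarrow> real^'n"
    and \<alpha> :: "nat \<Rightarrow> real"
    and d :: "nat \<Rightarrow> real^'n"
begin

abbreviation fk :: "nat \<Rightarrow> real" where "fk k \<equiv> f (x k)"
abbreviation g :: "nat \<Rightarrow> real^'n" where "g k \<equiv> gradf (x k)"

definition s :: "nat \<Rightarrow> real^'n" where "s j = x (Suc j) - x j"
definition y :: "nat \<Rightarrow> real^'n" where "y j = g (Suc j) - g j"

abbreviation sy :: "nat \<Rightarrow> real" where "sy j \<equiv> s j \<bullet> y j"

subsection \<open>Nonmonotone Wolfe line search\<close>

definition \<eta> :: "nat \<Rightarrow> real \<Rightarrow> real" where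
  "\<eta> k C =
     (if \<not> max 20 CARD('n) dvd k then 1
      else if C - fk (Suc k) > 0.999 * \<bar>C\<bar> then 0.7 else 0.999)"

text \<open>The pair \<open>(C k, Q k)\<close>.\<close>

fun CQ :: "nat \<Rightarrow> real \<times> real" where
  "CQ 0 = (fk 0, 1)"
| "CQ (Suc 0) = (min (fk 0) (fk 1 + 1), 2)"
| "CQ (Suc (Suc j)) =
     (let C = fst (CQ (Suc j)); Q = snd (CQ (Suc j)); e = \<eta> (Suc j) C
      in ((e * Q * C + fk (Suc (Suc j))) / (e * Q + 1), e * Q + 1))"

definition line_search :: bool where
  "line_search \<longleftrightarrow>
     (\<forall>k. 0 < \<alpha> k \<and> x (Suc k) = x k + \<alpha> k *\<^sub>R d k \<and>
          f (x k + \<alpha> k *\<^sub>R d k) \<le> fst (CQ k) + \<delta> * \<alpha> k * (g k \<bullet> d k) \<and>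
          gradf (x k + \<alpha> k *\<^sub>R d k) \<bullet> d k \<ge> \<sigma> * (g k \<bullet> d k))"

subsection \<open>Tests\<close>

definition t :: "nat \<Rightarrow> real" where
  "t k = \<bar>2 * (fk (k-1) - fk k + g k \<bullet> s (k-1)) / sy (k-1) - 1\<bar>"

definition t_le :: "nat \<Rightarrow> real \<Rightarrow> bool" where
  "t_le k c \<longleftrightarrow> 1 \<le> k \<and> sy (k-1) \<noteq> 0 \<and> t k \<le> c"

definition \<theta> :: "nat \<Rightarrow> real" where
  "\<theta> k = (fk (k-1) - fk k) / (0.5 * sy (k-1) - g k \<bullet> s (k-1))"

definition test_Q :: "nat \<Rightarrow> bool" where
  "test_Q k \<longleftrightarrow>
     (t_le k \<tau>\<^sub>1 \<or> (t_le k \<tau>\<^sub>2 \<and> t_le (k-1) \<tau>\<^sub>2)) \<or>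
     (0.5 * sy (k-1) - g k \<bullet> s (k-1) \<noteq> 0 \<and> \<bar>\<theta> k - 1\<bar> < \<gamma>) \<or>
     ((sy (k-1))\<^sup>2 \<le> 1 / 10^5 * (norm (s (k-1)))\<^sup>2 * (norm (y (k-1)))\<^sup>2 \<and>
      (fk k - fk (k-1) - 0.5 * (g (k-1) \<bullet> s (k-1) + g k \<bullet> s (k-1)))\<^sup>2
        \<le> 1 / 10^6 * (norm (s (k-1)))\<^sup>2 * (norm (y (k-1)))\<^sup>2)"

definition test_W :: "nat \<Rightarrow> bool" where
  "test_W k \<longleftrightarrow> s (k-1) \<noteq> 0 \<and> sy (k-1) \<noteq> 0 \<and>
     \<xi>\<^sub>1 \<le> sy (k-1) / (norm (s (k-1)))\<^sup>2 \<and>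
     sy (k-1) / (norm (s (k-1)))\<^sup>2 \<le> (norm (y (k-1)))\<^sup>2 / sy (k-1) \<and>
     (norm (y (k-1)))\<^sup>2 / sy (k-1) \<le> \<xi>\<^sub>2"

definition test_S :: "nat \<Rightarrow> bool" where
  "test_S k \<longleftrightarrow> s (k-1) \<noteq> 0 \<and> sy (k-1) \<noteq> 0 \<and> g k \<noteq> 0 \<and>
     \<bar>(g k \<bullet> y (k-1)) * (g k \<bullet> s (k-1))\<bar> / (sy (k-1) * (norm (g k))\<^sup>2) \<le> \<xi>\<^sub>3 \<and>
     \<xi>\<^sub>1 \<le> sy (k-1) / (norm (s (k-1)))\<^sup>2"

subsection \<open>Restart counters\<close>

text \<open>The test by which \<open>IterQuad\<close> grows when passing from iterate \<open>j\<close> to \<open>Suc j\<close>.\<close>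

definition quad_like :: "nat \<Rightarrow> bool" where
  "quad_like j \<longleftrightarrow>
     (let m = 0.5 * (g j \<bullet> s j + g (Suc j) \<bullet> s j)
      in (fk j + m \<noteq> 0 \<and> \<bar>fk (Suc j) / (fk j + m) - 1\<bar> \<le> \<xi>\<^sub>4) \<or>
         \<bar>fk (Suc j) - fk j - m\<bar> \<le> \<xi>\<^sub>5)"

primrec IterQuad :: "nat \<Rightarrow> nat" where
  "IterQuad 0 = 0"
| "IterQuad (Suc j) = (if quad_like j then Suc (IterQuad j) else 0)"

text \<open>
  The arguments \<open>ng\<close> and \<open>ir\<close> are the values of \<open>Isnotgra\<close> and of the already increased
  \<open>IterRestart\<close> at the moment \<open>d k\<close> is chosen.  The two cases in which the negative
  gradient is taken have the same effect on the counters and are not distinguished.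
\<close>

definition select :: "nat \<Rightarrow> nat \<Rightarrow> nat \<Rightarrow> step_kind" where
  "select k ng ir =
     (if ng = MaxRestart \<or> (IterQuad k = MinQuad \<and> ir \<noteq> IterQuad k) then Neg_Gradient
      else if test_W k \<and> test_Q k then Quadratic
      else if test_W k then Regularized
      else if test_S k then Hestenes_Stiefel
      else Neg_Gradient)"

text \<open>The pair \<open>(Isnotgra, IterRestart)\<close> after \<open>d k\<close> has been chosen.\<close>

primrec counters :: "nat \<Rightarrow> nat \<times> nat" where
  "counters 0 = (0, 0)"
| "counters (Suc j) =
     (let ng = fst (counters j); ir = Suc (snd (counters j))
      in if select (Suc j) ng ir = Neg_Gradient then (0, 0) else (Suc ng, ir))"

definition kind :: "nat \<Rightarrow> step_kind" where
  "kind k = select k (fst (counters (k-1))) (Suc (snd (counters (k-1))))"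

subsection \<open>Directions\<close>

definition \<rho> :: "nat \<Rightarrow> real" where
  "\<rho> k = 3/2 * ((norm (y (k-1)))\<^sup>2 / sy (k-1)) * (norm (g k))\<^sup>2"

definition B :: "nat \<Rightarrow> real^2^2" where
  "B k = vector [vector [\<rho> k, g k \<bullet> y (k-1)],
                 vector [g k \<bullet> y (k-1), sy (k-1)]]"

definition E :: "nat \<Rightarrow> real^2^2" where
  "E k = vector [vector [(norm (g k))\<^sup>2, g k \<bullet> s (k-1)],
                 vector [g k \<bullet> s (k-1), (norm (s (k-1)))\<^sup>2]]"

definition b :: "nat \<Rightarrow> real^2" where
  "b k = vector [(norm (g k))\<^sup>2, g k \<bullet> s (k-1)]"

definition \<mu>bar :: "nat \<Rightarrow> real" where
  "\<mu>bar k = 1 / det (B k) *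
     ((g k \<bullet> y (k-1)) * (g k \<bullet> s (k-1)) - sy (k-1) * (norm (g k))\<^sup>2)"

definition \<nu>bar :: "nat \<Rightarrow> real" where
  "\<nu>bar k = 1 / det (B k) *
     ((g k \<bullet> y (k-1)) * (norm (g k))\<^sup>2 - \<rho> k * (g k \<bullet> s (k-1)))"

definition quad_dir :: "nat \<Rightarrow> real^'n" where
  "quad_dir k = \<mu>bar k *\<^sub>R g k + \<nu>bar k *\<^sub>R s (k-1)"

definition HS_dir :: "nat \<Rightarrow> real^'n" where
  "HS_dir k = - g k + ((g k \<bullet> y (k-1)) / (d (k-1) \<bullet> y (k-1))) *\<^sub>R d (k-1)"

definition \<sigma>1 :: "nat \<Rightarrow> real" where
  "\<sigma>1 k = p * \<bar>fk (k-1) - fk k + g k \<bullet> s (k-1) - 1/2 * sy (k-1)\<bar> / sy (k-1) powr (p/2)"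

definition z1 :: "nat \<Rightarrow> real" where
  "z1 k = (THE z. 0 < z \<and>
     \<sigma>1 k * z powr (p - 1) + z - sqrt (b k \<bullet> (matrix_inv (B k) *v b k)) = 0)"

definition reg_dir1 :: "nat \<Rightarrow> real^'n" where
  "reg_dir1 k = (1 / (1 + min (\<sigma>1 k * z1 k powr (p - 2)) 1)) *\<^sub>R quad_dir k"

definition \<sigma>2 :: "nat \<Rightarrow> real" where
  "\<sigma>2 k = p * \<bar>fk (k-1) - fk k + g k \<bullet> s (k-1) - 1/2 * sy (k-1)\<bar> / norm (s (k-1)) powr (p/2)"

text \<open>
  \<open>V\<close> is unique only up to signs (up to any rotation if the two eigenvalues
  coincide), but the equation for \<open>z\<close> does not depend on its choice.
\<close>

definition z2 :: "nat \<Rightarrow> real" where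
  "z2 k = (THE z. 0 \<le> z \<and>
     (\<exists>V \<mu>\<^sub>1 \<mu>\<^sub>2 \<beta>. 0 < \<mu>\<^sub>1 \<and> \<mu>\<^sub>1 \<le> \<mu>\<^sub>2 \<and> orthogonal_matrix V \<and>
        transpose V ** (inv_sqrt (E k) ** B k ** inv_sqrt (E k)) ** V
          = vector [vector [\<mu>\<^sub>1, 0], vector [0, \<mu>\<^sub>2]] \<and>
        \<beta> = transpose V *v (inv_sqrt (E k) *v b k) \<and>
        z\<^sup>2 = (\<beta> $ 1)\<^sup>2 / (\<mu>\<^sub>1 + \<sigma>2 k * z powr (p - 2))\<^sup>2
            + (\<beta> $ 2)\<^sup>2 / (\<mu>\<^sub>2 + \<sigma>2 k * z powr (p - 2))\<^sup>2))"

definition lam :: "nat \<Rightarrow> real" where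
  "lam k =
     (if (g k \<bullet> s (k-1))\<^sup>2 > (1 - 1 / 10^5) * (norm (g k))\<^sup>2 * (norm (s (k-1)))\<^sup>2 then 0
      else min (\<sigma>2 k * z2 k powr (p - 2)) ((norm (y (k-1)))\<^sup>2 / sy (k-1)))"

definition \<Delta>bar :: "nat \<Rightarrow> real" where
  "\<Delta>bar k = (\<rho> k + lam k * (norm (g k))\<^sup>2) * (sy (k-1) + lam k * (norm (s (k-1)))\<^sup>2)
     - (g k \<bullet> y (k-1) + lam k * (g k \<bullet> s (k-1)))\<^sup>2"

definition \<mu>hat :: "nat \<Rightarrow> real" where
  "\<mu>hat k = 1 / \<Delta>bar k *
     ((g k \<bullet> y (k-1)) * (g k \<bullet> s (k-1)) - sy (k-1) * (norm (g k))\<^sup>2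
      + lam k * (g k \<bullet> s (k-1))\<^sup>2 - lam k * (norm (s (k-1)))\<^sup>2 * (norm (g k))\<^sup>2)"

definition \<nu>hat :: "nat \<Rightarrow> real" where
  "\<nu>hat k = 1 / \<Delta>bar k *
     ((g k \<bullet> y (k-1)) * (norm (g k))\<^sup>2 - \<rho> k * (g k \<bullet> s (k-1)))"

definition reg_dir2 :: "nat \<Rightarrow> real^'n" where
  "reg_dir2 k = \<mu>hat k *\<^sub>R g k + \<nu>hat k *\<^sub>R s (k-1)"

definition directions :: "(nat \<Rightarrow> real^'n) \<Rightarrow> bool" where
  "directions reg_dir \<longleftrightarrow>
     d 0 = - g 0 \<and>
     (\<forall>k\<ge>1. d k = (case kind k of
        Neg_Gradient \<Rightarrow> - g k
      | Quadratic \<Rightarrow> quad_dir k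
      | Regularized \<Rightarrow> reg_dir k
      | Hestenes_Stiefel \<Rightarrow> HS_dir k))"

definition pr1_run :: bool where
  "pr1_run \<longleftrightarrow> line_search \<and> directions reg_dir1"

definition pr2_run :: bool where
  "pr2_run \<longleftrightarrow> line_search \<and> directions reg_dir2"

end

end

(* Every subspace direction satisfies g \<bullet> d = - b\<^sup>T M\<^sup>-\<^sup>1 b, with b = (|g|\<^sup>2, g \<bullet> s) and
   M = B or M = B + \<lambda> E positive definite.  The Schur complement bounds this by - |g|\<^sup>4 / M11,
   and M11 = (3/2 |y|\<^sup>2 / (s \<bullet> y) + \<lambda>) |g|\<^sup>2 is at most 5/2 \<xi>2 |g|\<^sup>2 because \<lambda> never exceeds
   |y|\<^sup>2 / (s \<bullet> y) \<le> \<xi>2; the regularization of SMCG_PR1 costs a factor 2 at most.  Descent at one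
   iterate yields s \<bullet> y > 0, on which the next direction relies, so the argument is an
   induction on k. *)

theory Submission
  imports Defs
begin

text \<open>With M the symmetric matrix with rows (R, A) and (A, W), and v = (G, c), Cramer's rule
  turns the left-hand side into - v^T M^-1 v. Completing the square gives v^T M^-1 v = G^2/R + (R c
  - A G)^2 / (R det M), and the second summand is nonnegative.\<close>

lemma quadratic_form_inverse_bound:
  fixes R A W G c :: real
  assumes "0 < R" and "A\<^sup>2 < R * W"
  shows "1 / (R * W - A\<^sup>2) * (A * c - W * G) * G + 1 / (R * W - A\<^sup>2) * (A * G - R * c) * c
           \<le> - (G\<^sup>2 / R)"
proof -
  have D: "0 < R * W - A\<^sup>2"
    using assms(2) by simp
  have "G\<^sup>2 * (R * W - A\<^sup>2) \<le> (W * G\<^sup>2 - 2 * A * c * G + R * c\<^sup>2) * R"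
    using zero_le_power2[of "R * c - A * G"] by (simp add: power2_eq_square algebra_simps)
  then have "G\<^sup>2 / R \<le> (W * G\<^sup>2 - 2 * A * c * G + R * c\<^sup>2) / (R * W - A\<^sup>2)"
    using assms(1) D by (simp add: divide_le_eq le_divide_eq)
  moreover have "1 / (R * W - A\<^sup>2) * (A * c - W * G) * G + 1 / (R * W - A\<^sup>2) * (A * G - R * c) * c
      = - ((W * G\<^sup>2 - 2 * A * c * G + R * c\<^sup>2) / (R * W - A\<^sup>2))"
    by (simp add: add_divide_distrib[symmetric] minus_divide_left)
      (simp add: power2_eq_square algebra_simps)
  ultimately show ?thesis
    by linarith
qed

text \<open>As a polynomial in \<open>l\<close>, the determinant of the sum has a positive constant
  term and nonnegative higher coefficients. The linear one is the mixed term, bounded below by the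
  inequality of arithmetic and geometric means.\<close>

lemma posdef_add_psd:
  fixes R A W G c S l :: real
  assumes "0 < R" and "0 < W" and "A\<^sup>2 < R * W" and "0 \<le> G" and "0 \<le> S" and "c\<^sup>2 \<le> G * S"
    and "0 \<le> l"
  shows "(A + l * c)\<^sup>2 < (R + l * G) * (W + l * S)"
proof -
  \<comment> \<open>The product of the two determinant conditions regroups as (R S)(G W), whose
    fourfold is at most (R S + G W)^2.\<close>
  have "A\<^sup>2 * c\<^sup>2 \<le> (R * W) * (G * S)"
    using assms by (intro mult_mono) auto
  then have "(2 * (A * c))\<^sup>2 \<le> (R * S + G * W)\<^sup>2"
    using zero_le_power2[of "R * S - G * W"] by (simp add: power2_eq_square algebra_simps)
  moreover have "0 \<le> R * S + G * W"
    using assms by simp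
  ultimately have "2 * (A * c) \<le> R * S + G * W"
    by (rule power2_le_imp_le)
  then have "0 \<le> l * (R * S + G * W - 2 * (A * c))"
    using assms(7) by simp
  moreover have "0 \<le> l\<^sup>2 * (G * S - c\<^sup>2)"
    using assms(6) by simp
  moreover have "(R + l * G) * (W + l * S) - (A + l * c)\<^sup>2
      = (R * W - A\<^sup>2) + l * (R * S + G * W - 2 * (A * c)) + l\<^sup>2 * (G * S - c\<^sup>2)"
    by (simp add: power2_eq_square algebra_simps)
  ultimately show ?thesis
    using assms(3) by linarith
qed

section \<open>Descent along the subspace directions\<close>

context smcg_pr
begin

text \<open>The factor 3/2 in \<open>\<rho>\<close> makes Cauchy-Schwarz strict, so
  \<open>B k\<close> is positive definite even when \<open>g k\<close> and \<open>y (k-1)\<close>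
  are parallel.\<close>

lemma inner_square_less_rho_mult:
  assumes "0 < sy (k-1)" and "g k \<noteq> 0"
  shows "0 < \<rho> k" and "(g k \<bullet> y (k-1))\<^sup>2 < \<rho> k * sy (k-1)"
proof -
  have "y (k-1) \<noteq> 0"
    using assms(1) by auto
  then show "0 < \<rho> k"
    using assms by (simp add: \<rho>_def)
  have "(g k \<bullet> y (k-1))\<^sup>2 \<le> (norm (g k))\<^sup>2 * (norm (y (k-1)))\<^sup>2"
    using Cauchy_Schwarz_ineq[of "g k" "y (k-1)"] by (simp add: power2_norm_eq_inner)
  also have "\<dots> < 3/2 * ((norm (g k))\<^sup>2 * (norm (y (k-1)))\<^sup>2)"
    using \<open>y (k-1) \<noteq> 0\<close> assms(2) by simp
  also have "\<dots> = \<rho> k * sy (k-1)"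
    using assms(1) by (simp add: \<rho>_def)
  finally show "(g k \<bullet> y (k-1))\<^sup>2 < \<rho> k * sy (k-1)" .
qed

text \<open>Used with \<open>l = 0\<close> for \<open>B k\<close> itself and with
  \<open>l = lam k\<close> for SMCG_PR2.\<close>

lemma div_rho_add_bound:
  assumes "0 < sy (k-1)" and "g k \<noteq> 0" and "test_W k"
    and "0 \<le> l" and "l \<le> (norm (y (k-1)))\<^sup>2 / sy (k-1)"
  shows "2 / (5 * \<xi>\<^sub>2) * (norm (g k))\<^sup>2 \<le> ((norm (g k))\<^sup>2)\<^sup>2 / (\<rho> k + l * (norm (g k))\<^sup>2)"
proof -
  define q where "q = (norm (y (k-1)))\<^sup>2 / sy (k-1)"
  have q: "q \<le> \<xi>\<^sub>2" "l \<le> q"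
    using assms by (auto simp: q_def test_W_def)
  have "y (k-1) \<noteq> 0"
    using assms(1) by auto
  then have "0 < q"
    using assms(1) by (simp add: q_def)
  have "\<rho> k + l * (norm (g k))\<^sup>2 = (3/2 * q + l) * (norm (g k))\<^sup>2"
    by (simp add: \<rho>_def q_def algebra_simps)
  then have "((norm (g k))\<^sup>2)\<^sup>2 / (\<rho> k + l * (norm (g k))\<^sup>2) = 1 / (3/2 * q + l) * (norm (g k))\<^sup>2"
    using assms(2) by (simp add: power2_eq_square)
  \<comment> \<open>Here 3/2 q + l is at most 5/2 q, hence at most
    \<open>5/2 * \<xi>\<^sub>2\<close>.\<close>
  moreover have "1 / (5/2 * \<xi>\<^sub>2) \<le> 1 / (3/2 * q + l)"
    using \<open>0 < q\<close> q assms(4) by (intro divide_left_mono mult_pos_pos) auto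
  ultimately show ?thesis
    using mult_right_mono[of "1 / (5/2 * \<xi>\<^sub>2)" "1 / (3/2 * q + l)" "(norm (g k))\<^sup>2"] by simp
qed

lemma quad_dir_descent:
  assumes "0 < sy (k-1)" and "g k \<noteq> 0" and "test_W k"
  shows "g k \<bullet> quad_dir k \<le> - (((norm (g k))\<^sup>2)\<^sup>2 / \<rho> k)"
proof -
  note R = inner_square_less_rho_mult[OF assms(1,2)]
  have "det (B k) = \<rho> k * sy (k-1) - (g k \<bullet> y (k-1))\<^sup>2"
    by (simp add: B_def det_2 power2_eq_square)
  then show ?thesis
    using quadratic_form_inverse_bound[OF R, of "g k \<bullet> s (k-1)" "(norm (g k))\<^sup>2"]
    by (simp add: quad_dir_def \<mu>bar_def \<nu>bar_def inner_add_right power2_norm_eq_inner)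
qed

text \<open>The scaling factor lies between 1/2 and 1, because \<open>powr\<close> is nonnegative
  whatever real number \<open>z1 k\<close> is.\<close>

lemma reg_dir1_descent:
  assumes "0 < p" and "g k \<bullet> quad_dir k \<le> 0"
  shows "g k \<bullet> reg_dir1 k \<le> 1/2 * (g k \<bullet> quad_dir k)"
proof -
  define m where "m = min (\<sigma>1 k * z1 k powr (p - 2)) 1"
  have "0 \<le> m" "m \<le> 1"
    using assms(1) by (auto simp: m_def \<sigma>1_def)
  then have "1/2 \<le> 1 / (1 + m)"
    by (simp add: field_simps)
  then have "1 / (1 + m) * (g k \<bullet> quad_dir k) \<le> 1/2 * (g k \<bullet> quad_dir k)"
    using assms(2) by (rule mult_right_mono_neg)
  then show ?thesis
    by (simp only: reg_dir1_def inner_scaleR_right m_def)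
qed

text \<open>The lower bound keeps \<open>B k\<close> plus \<open>lam k\<close> times
  \<open>E k\<close> positive definite; the upper one feeds
  \<open>div_rho_add_bound\<close>.\<close>

lemma lam_bounds:
  assumes "0 < p" and "0 < sy (k-1)"
  shows "0 \<le> lam k" and "lam k \<le> (norm (y (k-1)))\<^sup>2 / sy (k-1)"
  using assms by (auto simp: lam_def \<sigma>2_def)

lemma reg_dir2_descent:
  assumes "0 < p" and "0 < sy (k-1)" and "g k \<noteq> 0"
  shows "g k \<bullet> reg_dir2 k \<le> - (((norm (g k))\<^sup>2)\<^sup>2 / (\<rho> k + lam k * (norm (g k))\<^sup>2))"
proof -
  let ?G = "(norm (g k))\<^sup>2" and ?S = "(norm (s (k-1)))\<^sup>2"
  let ?a = "g k \<bullet> y (k-1)" and ?c = "g k \<bullet> s (k-1)" and ?l = "lam k"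
  note R = inner_square_less_rho_mult[OF assms(2,3)]
  note l = lam_bounds(1)[OF assms(1,2)]
  \<comment> \<open>\<open>E k\<close> is the Gram matrix of \<open>g k\<close> and
    \<open>s (k-1)\<close>, hence positive semidefinite.\<close>
  have "?c\<^sup>2 \<le> ?G * ?S"
    using Cauchy_Schwarz_ineq[of "g k" "s (k-1)"] by (simp add: power2_norm_eq_inner)
  then have D: "(?a + ?l * ?c)\<^sup>2 < (\<rho> k + ?l * ?G) * (sy (k-1) + ?l * ?S)"
    using R assms(2) l by (intro posdef_add_psd) auto
  have "0 < \<rho> k + ?l * ?G"
    using R(1) l by (simp add: add_pos_nonneg)
  from quadratic_form_inverse_bound[OF this D, of ?c ?G]
  have "1 / \<Delta>bar k * ((?a + ?l * ?c) * ?c - (sy (k-1) + ?l * ?S) * ?G) * ?G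
      + 1 / \<Delta>bar k * ((?a + ?l * ?c) * ?G - (\<rho> k + ?l * ?G) * ?c) * ?c
      \<le> - (?G\<^sup>2 / (\<rho> k + ?l * ?G))"
    by (simp only: \<Delta>bar_def)
  moreover have "\<mu>hat k = 1 / \<Delta>bar k * ((?a + ?l * ?c) * ?c - (sy (k-1) + ?l * ?S) * ?G)"
    unfolding \<mu>hat_def by (simp add: power2_eq_square algebra_simps)
  \<comment> \<open>The two contributions of \<open>lam k\<close> to this numerator cancel, which is
    why \<open>\<nu>hat\<close> shows none outside \<open>\<Delta>bar\<close>.\<close>
  moreover have "\<nu>hat k = 1 / \<Delta>bar k * ((?a + ?l * ?c) * ?G - (\<rho> k + ?l * ?G) * ?c)"
    unfolding \<nu>hat_def by (simp add: algebra_simps)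
  ultimately show ?thesis
    by (simp add: reg_dir2_def inner_add_right power2_norm_eq_inner)
qed

section \<open>Line search and the Hestenes-Stiefel direction\<close>

lemma line_search_step:
  assumes line_search
  shows "s j = \<alpha> j *\<^sub>R d j" and "0 < \<alpha> j"
  using assms by (auto simp: line_search_def s_def)

text \<open>Along a descent direction the slope is negative, so \<sigma> < 1 and the second Wolfe
  condition force it to increase strictly.\<close>

lemma line_search_curvature:
  assumes line_search and "\<sigma> < 1" and "g j \<bullet> d j < 0"
  shows "0 < sy j"
proof -
  have "\<sigma> * (g j \<bullet> d j) \<le> g (Suc j) \<bullet> d j"
    using assms(1) by (simp add: line_search_def)
  moreover have "g j \<bullet> d j < \<sigma> * (g j \<bullet> d j)"
    using mult_strict_right_mono_neg[OF assms(2,3)] by simp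
  ultimately have "0 < d j \<bullet> y j"
    by (simp add: y_def inner_diff_right inner_commute)
  then show ?thesis
    using line_search_step[OF assms(1)] by simp
qed

lemma HS_dir_descent:
  assumes line_search and "0 < sy (k-1)" and "test_S k"
  shows "g k \<bullet> HS_dir k \<le> - ((1 - \<xi>\<^sub>3) * (norm (g k))\<^sup>2)"
proof -
  let ?a = "g k \<bullet> y (k-1)" and ?c = "g k \<bullet> s (k-1)"
  \<comment> \<open>The step length cancels, so \<open>d (k-1)\<close> may be replaced by
    \<open>s (k-1)\<close>, the vector in which test (S) is phrased.\<close>
  have "?a / (d (k-1) \<bullet> y (k-1)) * (g k \<bullet> d (k-1)) = ?a * ?c / sy (k-1)"
    using line_search_step[OF assms(1), of "k-1"] by simp
  then have "g k \<bullet> HS_dir k = - (norm (g k))\<^sup>2 + ?a * ?c / sy (k-1)"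
    unfolding HS_dir_def inner_add_right inner_scaleR_right
    by (simp add: power2_norm_eq_inner)
  moreover have "\<bar>?a * ?c\<bar> \<le> \<xi>\<^sub>3 * (sy (k-1) * (norm (g k))\<^sup>2)"
    using assms(2,3) by (simp add: test_S_def divide_le_eq)
  then have "?a * ?c / sy (k-1) \<le> \<xi>\<^sub>3 * (norm (g k))\<^sup>2"
    using assms(2) by (simp add: divide_le_eq ac_simps abs_le_iff)
  ultimately show ?thesis
    by (simp add: algebra_simps)
qed

lemma kind_cases:
  "kind k = Neg_Gradient \<or> kind k = Quadratic \<and> test_W k \<or>
   kind k = Regularized \<and> test_W k \<or> kind k = Hestenes_Stiefel \<and> test_S k"
  by (simp add: kind_def select_def)

text \<open>The Hestenes-Stiefel direction contributes \<open>1 - \<xi>\<^sub>3\<close>. The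
  subspace directions give \<open>2 / (5 * \<xi>\<^sub>2)\<close>, halved to allow for the damping
  in SMCG_PR1.\<close>

lemma sufficient_descent:
  assumes par: "0 < p" "\<sigma> < 1" "0 < \<xi>\<^sub>2" "0 < \<xi>\<^sub>3" "\<xi>\<^sub>3 < 1"
    and ls: line_search and dirs: "directions reg" and reg: "reg = reg_dir1 \<or> reg = reg_dir2"
    and g: "\<And>k. g k \<noteq> 0"
  shows "g k \<bullet> d k \<le> - min (1 - \<xi>\<^sub>3) (1 / (5 * \<xi>\<^sub>2)) * (norm (g k))\<^sup>2"
proof -
  define m where "m = min (1 - \<xi>\<^sub>3) (1 / (5 * \<xi>\<^sub>2))"
  have m: "0 < m" "m \<le> 1" "m \<le> 1 - \<xi>\<^sub>3" "m \<le> 1 / (5 * \<xi>\<^sub>2)"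
    using par by (auto simp: m_def)
  have weaken: "v \<le> - m * (norm (g k))\<^sup>2" if "v \<le> - (C * (norm (g k))\<^sup>2)" "m \<le> C" for v C k
    using that mult_right_mono[of m C "(norm (g k))\<^sup>2"] by simp
  have neg: "g k \<bullet> (- g k) \<le> - m * (norm (g k))\<^sup>2" for k
    using m(2) by (intro weaken[of _ 1]) (auto simp: power2_norm_eq_inner)
  have "g k \<bullet> d k \<le> - m * (norm (g k))\<^sup>2"
  proof (induction k)
    case 0
    then show ?case
      using dirs neg by (simp add: directions_def)
  next
    case (Suc j)
    let ?k = "Suc j"
    \<comment> \<open>Since \<open>g j\<close> is nonzero, the induction hypothesis gives a strictly
      negative slope at \<open>j\<close>, which the curvature lemma requires.\<close>
    have "0 < m * (norm (g j))\<^sup>2"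
      using m(1) g by simp
    then have "g j \<bullet> d j < 0"
      using Suc.IH by linarith
    then have sy: "0 < sy (?k-1)"
      using line_search_curvature ls par(2) by simp
    have d: "d ?k = (case kind ?k of Neg_Gradient \<Rightarrow> - g ?k | Quadratic \<Rightarrow> quad_dir ?k
        | Regularized \<Rightarrow> reg ?k | Hestenes_Stiefel \<Rightarrow> HS_dir ?k)"
      using dirs unfolding directions_def by simp
    have rho: "2 / (5 * \<xi>\<^sub>2) * (norm (g ?k))\<^sup>2
        \<le> ((norm (g ?k))\<^sup>2)\<^sup>2 / (\<rho> ?k + l * (norm (g ?k))\<^sup>2)"
      if "test_W ?k" "0 \<le> l" "l \<le> (norm (y (?k-1)))\<^sup>2 / sy (?k-1)" for l
      using div_rho_add_bound[OF sy g that] .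
    have quad: "g ?k \<bullet> quad_dir ?k \<le> - (2 / (5 * \<xi>\<^sub>2) * (norm (g ?k))\<^sup>2)" if "test_W ?k"
      using quad_dir_descent[OF sy g that] rho[OF that, of 0] sy by simp
    consider "kind ?k = Neg_Gradient" | "kind ?k = Quadratic" "test_W ?k"
      | "kind ?k = Regularized" "test_W ?k" | "kind ?k = Hestenes_Stiefel" "test_S ?k"
      using kind_cases by blast
    then show ?case
    proof cases
      case 1
      then show ?thesis
        using d neg by simp
    next
      case 2
      have "m \<le> 2 / (5 * \<xi>\<^sub>2)"
        using m(4) par(3) by (simp add: field_simps)
      from weaken[OF quad[OF 2(2)] this] show ?thesis
        using d 2(1) by simp
    next
      case 3
      from reg show ?thesis
      proof
        assume r: "reg = reg_dir1"
        have "0 \<le> 2 / (5 * \<xi>\<^sub>2) * (norm (g ?k))\<^sup>2"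
          using par(3) by simp
        then have "g ?k \<bullet> quad_dir ?k \<le> 0"
          using quad[OF 3(2)] by linarith
        from reg_dir1_descent[OF par(1) this]
        have "g ?k \<bullet> reg_dir1 ?k \<le> - (1 / (5 * \<xi>\<^sub>2) * (norm (g ?k))\<^sup>2)"
          using quad[OF 3(2)] by simp
        from weaken[OF this m(4)] show ?thesis
          using d 3(1) r by simp
      next
        assume r: "reg = reg_dir2"
        have "g ?k \<bullet> reg_dir2 ?k \<le> - (2 / (5 * \<xi>\<^sub>2) * (norm (g ?k))\<^sup>2)"
          using reg_dir2_descent[OF par(1) sy g] rho[OF 3(2) lam_bounds[OF par(1) sy]]
          by linarith
        moreover have "m \<le> 2 / (5 * \<xi>\<^sub>2)"
          using m(4) par(3) by (simp add: field_simps)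
        ultimately have "g ?k \<bullet> reg_dir2 ?k \<le> - m * (norm (g ?k))\<^sup>2"
          by (rule weaken)
        then show ?thesis
          using d 3(1) r by simp
      qed
    next
      case 4
      from weaken[OF HS_dir_descent[OF ls sy 4(2)] m(3)] show ?thesis
        using d 4(1) by simp
    qed
  qed
  then show ?thesis
    by (simp add: m_def)
qed

end

theorem lemma4p1:
  fixes p \<delta> \<sigma> \<xi>\<^sub>1 \<xi>\<^sub>2 \<xi>\<^sub>3 \<xi>\<^sub>4 \<xi>\<^sub>5 \<tau>\<^sub>1 \<tau>\<^sub>2 \<gamma> :: real
    and MaxRestart MinQuad :: nat
    and f :: "real^'n \<Rightarrow> real"
    and gradf :: "real^'n \<Rightarrow> real^'n"
    and x :: "nat \<Rightarrow> real^'n"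
    and \<alpha> :: "nat \<Rightarrow> real"
    and d :: "nat \<Rightarrow> real^'n"
  assumes "p > 2" and "0 < \<delta>" and "\<delta> < \<sigma>" and "\<sigma> < 1"
    and "\<xi>\<^sub>1 > 0" and "\<xi>\<^sub>2 > 0" and "0 < \<xi>\<^sub>3" and "\<xi>\<^sub>3 < 1" and "\<xi>\<^sub>4 > 0" and "\<xi>\<^sub>5 > 0"
    and "\<tau>\<^sub>1 > 0" and "\<tau>\<^sub>2 > 0" and "0 < \<gamma>" and "\<gamma> < 1"
    and "MaxRestart > 0" and "MinQuad > 0"
    and "\<And>u. GDERIV f u :> gradf u" and "continuous_on UNIV gradf"
    and "smcg_pr.pr1_run p \<delta> \<sigma> \<xi>\<^sub>1 \<xi>\<^sub>2 \<xi>\<^sub>3 \<xi>\<^sub>4 \<xi>\<^sub>5 \<tau>\<^sub>1 \<tau>\<^sub>2 \<gamma> MaxRestart MinQuad f gradf x \<alpha> d \<or>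
         smcg_pr.pr2_run p \<delta> \<sigma> \<xi>\<^sub>1 \<xi>\<^sub>2 \<xi>\<^sub>3 \<xi>\<^sub>4 \<xi>\<^sub>5 \<tau>\<^sub>1 \<tau>\<^sub>2 \<gamma> MaxRestart MinQuad f gradf x \<alpha> d"
    and "\<And>k. gradf (x k) \<noteq> 0"
  shows "\<exists>c\<^sub>1>0. \<forall>k. gradf (x k) \<bullet> d k \<le> - c\<^sub>1 * (norm (gradf (x k)))\<^sup>2"
proof -
  interpret smcg_pr p \<delta> \<sigma> \<xi>\<^sub>1 \<xi>\<^sub>2 \<xi>\<^sub>3 \<xi>\<^sub>4 \<xi>\<^sub>5 \<tau>\<^sub>1 \<tau>\<^sub>2 \<gamma> MaxRestart MinQuad f gradf x \<alpha> d .
  \<comment> \<open>The two methods differ only in the regularized direction, so one choice of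
    \<open>reg\<close> treats both.\<close>
  obtain reg where "line_search" "directions reg" "reg = reg_dir1 \<or> reg = reg_dir2"
    using assms(19) by (auto simp: pr1_run_def pr2_run_def)
  with sufficient_descent[of reg] assms
  have "\<forall>k. gradf (x k) \<bullet> d k \<le> - min (1 - \<xi>\<^sub>3) (1 / (5 * \<xi>\<^sub>2)) * (norm (gradf (x k)))\<^sup>2"
    by simp
  moreover have "0 < min (1 - \<xi>\<^sub>3) (1 / (5 * \<xi>\<^sub>2))"
    using assms by simp
  ultimately show ?thesis
    by blast
qed

end
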